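(* Let $n\ge2$ and $s\in(1/2,1)$. Assume that $\Phi\in C^2_{\mathrm b}(\mathbb{R})$ is nondecreasing, and let $\phi\in C^2_{\mathrm b}(\mathbb{R}^n)$ be defined by $\phi(x):=\Phi(x_1)$, where $x=(x_1,\dots,x_n)$. Then, for all $x\in\mathbb{R}^n$, $$\Delta^s_\infty\phi(x)=-(-\partial^2_{x_1x_1})^s\Phi(x_1).$$
   Context: $C_s=\frac{4^s s\,\Gamma(\frac12+s)}{\pi^{1/2}\Gamma(1-s)}$. $C^2_{\mathrm b}$: functions with bounded continuous derivatives of orders $0,1,2$. For $\phi\in C_{\mathrm b}^2(\mathbb{R}^n)$: if $\nabla\phi(x)\ne0$, with $\zeta=\nabla\phi(x)/|\nabla\phi(x)|$, $$\Delta^s_\infty\phi(x)=C_s\int_0^\infty(\phi(x+\eta\zeta)+\phi(x-\eta\zeta)-2\phi(x))\frac{d\eta}{\eta^{1+2s}};$$ if $\nabla\phi(x)=0$, $$\Delta^s_\infty\phi(x)=C_s\sup_{|y|=1}\int_0^\infty(\phi(x+\eta y)-\phi(x))\frac{d\eta}{\eta^{1+2s}}+C_s\inf_{|y|=1}\int_0^\infty(\phi(x-\eta y)-\phi(x))\frac{d\eta}{\eta^{1+2s}}.$$ The one-dimensional fractional Laplacian is $-(-\partial^2_{x_1x_1})^s\Phi(x_1)=C_s\int_0^\infty(\Phi(x_1+\eta)+\Phi(x_1-\eta)-2\Phi(x_1))\frac{d\eta}{\eta^{1+2s}}$. *)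

theory Defs
  imports "HOL-Analysis.Analysis"
begin

(* The library derivative of a derivative lives in a space of bounded linear maps, so one
   definition covers both the line and Euclidean n-space. *)
definition C2b :: "('a::real_normed_vector \<Rightarrow> real) \<Rightarrow> bool" where
  "C2b f \<longleftrightarrow> (\<exists>(Df :: 'a \<Rightarrow> 'a \<Rightarrow>\<^sub>L real) (D2f :: 'a \<Rightarrow> 'a \<Rightarrow>\<^sub>L 'a \<Rightarrow>\<^sub>L real).
     (\<forall>x. (f has_derivative blinfun_apply (Df x)) (at x)) \<and>
     (\<forall>x. (Df has_derivative blinfun_apply (D2f x)) (at x)) \<and>
     continuous_on UNIV f \<and> bounded (range f) \<and>
     continuous_on UNIV Df \<and> bounded (range Df) \<and>
     continuous_on UNIV D2f \<and> bounded (range D2f))"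

definition grad :: "('a::real_inner \<Rightarrow> real) \<Rightarrow> 'a \<Rightarrow> 'a" where
  "grad f x = (THE D. GDERIV f x :> D)"

definition frac_const :: "real \<Rightarrow> real" where
  "frac_const s = 4 powr s * s * Gamma (1/2 + s) / (pi powr (1/2) * Gamma (1 - s))"

(* For f in C2b and 1/2 < s < 1 all the integrals below converge absolutely (in the zero-gradient
   case the first-order term at 0 vanishes) and are bounded uniformly in the unit vector y, so
   that the real-valued integral, supremum and infimum have their usual meaning. *)
definition frac_inf_laplacian :: "real \<Rightarrow> ('a::real_inner \<Rightarrow> real) \<Rightarrow> 'a \<Rightarrow> real" where
  "frac_inf_laplacian s f x =
    (if grad f x \<noteq> 0 then
       (let \<zeta> = grad f x /\<^sub>R norm (grad f x) in
        frac_const s *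
          (LBINT \<eta>:{0<..}. (f (x + \<eta> *\<^sub>R \<zeta>) + f (x - \<eta> *\<^sub>R \<zeta>) - 2 * f x) / \<eta> powr (1 + 2 * s)))
     else
       frac_const s *
         (SUP y\<in>{y. norm y = 1}. LBINT \<eta>:{0<..}. (f (x + \<eta> *\<^sub>R y) - f x) / \<eta> powr (1 + 2 * s)) +
       frac_const s *
         (INF y\<in>{y. norm y = 1}. LBINT \<eta>:{0<..}. (f (x - \<eta> *\<^sub>R y) - f x) / \<eta> powr (1 + 2 * s)))"

(* The positive operator; note the sign in front of the integral. *)
definition frac_laplacian_1d :: "real \<Rightarrow> (real \<Rightarrow> real) \<Rightarrow> real \<Rightarrow> real" where
  "frac_laplacian_1d s f t =
     - (frac_const s * (LBINT \<eta>:{0<..}. (f (t + \<eta>) + f (t - \<eta>) - 2 * f t) / \<eta> powr (1 + 2 * s)))"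

lemma C2b_compose_blinfun:
  fixes L :: "'a::real_normed_vector \<Rightarrow>\<^sub>L 'b::real_normed_vector" and f :: "'b \<Rightarrow> real"
  assumes "C2b f"
  shows "C2b (\<lambda>x. f (blinfun_apply L x))"
proof -
  obtain Df D2f where
    d1: "\<And>x. (f has_derivative blinfun_apply (Df x)) (at x)" and
    d2: "\<And>x. (Df has_derivative blinfun_apply (D2f x)) (at x)" and
    c: "continuous_on UNIV f" "continuous_on UNIV Df" "continuous_on UNIV D2f" and
    b: "bounded (range f)" "bounded (range Df)" "bounded (range D2f)"
    using assms unfolding C2b_def by blast
  have blR: "bounded_linear (\<lambda>A :: 'b \<Rightarrow>\<^sub>L real. A o\<^sub>L L)"
    by (rule bounded_bilinear.bounded_linear_left[OF bounded_bilinear_blinfun_compose])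
  define R where "R = Blinfun (\<lambda>A :: 'b \<Rightarrow>\<^sub>L real. A o\<^sub>L L)"
  have R: "blinfun_apply R A = A o\<^sub>L L" for A
    unfolding R_def by (simp add: bounded_linear_Blinfun_apply[OF blR])
  have blS: "bounded_linear (\<lambda>B :: 'b \<Rightarrow>\<^sub>L 'b \<Rightarrow>\<^sub>L real. (R o\<^sub>L B) o\<^sub>L L)"
    by (intro bounded_linear_compose
        [OF bounded_bilinear.bounded_linear_left[OF bounded_bilinear_blinfun_compose]
            bounded_bilinear.bounded_linear_right[OF bounded_bilinear_blinfun_compose]])
  have dL: "(blinfun_apply L has_derivative blinfun_apply L) (at x)" for x
    by (rule bounded_linear_imp_has_derivative[OF blinfun.bounded_linear_right])
  have cL: "continuous_on UNIV (blinfun_apply L)"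
    by (rule linear_continuous_on[OF blinfun.bounded_linear_right])
  have e1: "((\<lambda>x. f (blinfun_apply L x)) has_derivative
      blinfun_apply (Df (blinfun_apply L x) o\<^sub>L L)) (at x)" for x
    using has_derivative_compose[OF dL[of x] d1] by (simp add: o_def blinfun_compose.rep_eq)
  have e2: "((\<lambda>x. Df (blinfun_apply L x) o\<^sub>L L) has_derivative
      blinfun_apply ((R o\<^sub>L D2f (blinfun_apply L x)) o\<^sub>L L)) (at x)" for x
    using bounded_linear.has_derivative[OF blR has_derivative_compose[OF dL[of x] d2]]
    by (simp add: o_def R blinfun_compose.rep_eq)
  have bd0: "bounded (range (\<lambda>x. f (blinfun_apply L x)))"
    using b(1) by (rule bounded_subset) auto
  have b1: "bounded (range (\<lambda>x. Df (blinfun_apply L x) o\<^sub>L L))"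
    by (rule bounded_subset[OF bounded_linear_image[OF b(2) blR]]) auto
  have b2: "bounded (range (\<lambda>x. (R o\<^sub>L D2f (blinfun_apply L x)) o\<^sub>L L))"
    by (rule bounded_subset[OF bounded_linear_image[OF b(3) blS]]) auto
  have cc: "continuous_on UNIV (\<lambda>x. g (blinfun_apply L x))"
    if "continuous_on UNIV g" for g :: "'b \<Rightarrow> 'c::topological_space"
    using continuous_on_compose2[OF that cL] by simp
  have c1: "continuous_on UNIV (\<lambda>x. Df (blinfun_apply L x) o\<^sub>L L)"
    by (rule bounded_linear.continuous_on[OF blR cc[OF c(2)]])
  have c2: "continuous_on UNIV (\<lambda>x. (R o\<^sub>L D2f (blinfun_apply L x)) o\<^sub>L L)"
    by (rule bounded_linear.continuous_on[OF blS cc[OF c(3)]])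
  show ?thesis
    unfolding C2b_def
    using e1 e2 cc[OF c(1)] c1 c2 bd0 b1 b2
    by (intro exI[of _ "\<lambda>x. Df (blinfun_apply L x) o\<^sub>L L"]
        exI[of _ "\<lambda>x. (R o\<^sub>L D2f (blinfun_apply L x)) o\<^sub>L L"]) blast
qed

lemma C2b_coordinate:
  fixes k :: "'n::finite"
  assumes "C2b \<Phi>"
  shows "C2b (\<lambda>x :: real ^ 'n. \<Phi> (x $ k))"
  using C2b_compose_blinfun[OF assms, of "Blinfun (\<lambda>x :: real ^ 'n. x $ k)"]
  by (simp add: bounded_linear_Blinfun_apply bounded_linear_vec_nth)

end

theory Submission
  imports Defs
begin

text \<open>The gradient of \<open>\<phi>\<close> at \<open>x\<close> is \<open>\<Phi>'(x\<^sub>1)\<close> times the first basis vector. If it is nonzero,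
  monotonicity makes its direction exactly that vector and the two integrals are literally equal.
  If it vanishes, monotonicity shows that among the unit vectors \<open>y\<close>, whose first component is at
  most \<open>1\<close>, the first basis vector attains both the supremum and the infimum, so that the two
  one-sided integrals add up; they converge since the first-order term of \<open>\<Phi>\<close> vanishes.\<close>

text \<open>\<open>grad\<close> is a definite description, so uniqueness has to be shown: two
  gradients represent the same derivative, and evaluating both functionals at \<open>E - D\<close>
  forces \<open>E = D\<close>.\<close>

lemma grad_eqI:
  assumes "GDERIV f x :> D"
  shows "grad f x = D"
  unfolding grad_def
proof (rule the_equality)
  fix E assume "GDERIV f x :> E"
  then have "(\<lambda>h. inner h E) = (\<lambda>h. inner h D)"
    using assms unfolding gderiv_def by (rule has_derivative_unique)
  then have "inner h E = inner h D" for h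
    by (rule fun_cong)
  then have "inner (E - D) (E - D) = 0"
    unfolding inner_diff_right[of _ E D] by simp
  then show "E = D" by simp
qed (rule assms)

text \<open>For a nonnegative function, gauge integrability is absolute integrability for completed
  Lebesgue measure; Borel measurability then allows the descent to \<open>lborel\<close>.\<close>

lemma set_integrable_powr_to_0:
  fixes a c :: real
  assumes "a > -1" "c \<ge> 0"
  shows "set_integrable lborel {0<..c} (\<lambda>x. x powr a)"
proof -
  have "(\<lambda>x. x powr a) absolutely_integrable_on {0<..c}"
    using assms by (intro nonnegative_absolutely_integrable_1 integrable_on_powr_from_0') auto
  then show ?thesis
    unfolding set_integrable_def by (subst (asm) integrable_completion) auto
qed

lemma set_integrable_powr_to_inf:
  fixes a c :: real
  assumes "a < -1" "c > 0"
  shows "set_integrable lborel {c..} (\<lambda>x. x powr a)"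
proof -
  have "(\<lambda>x. x powr a) absolutely_integrable_on {c..}"
    using has_integral_powr_to_inf[OF assms]
    by (intro nonnegative_absolutely_integrable_1) (auto simp: integrable_on_def)
  then show ?thesis
    unfolding set_integrable_def by (subst (asm) integrable_completion) auto
qed

text \<open>The half-line is split at 1. Near 0 the quadratic bound leaves
  \<open>t powr (2 - p)\<close>, integrable because \<open>p < 3\<close>; at infinity boundedness
  leaves \<open>t powr (- p)\<close>, integrable because \<open>1 < p\<close>.\<close>

lemma set_integrable_over_powr:
  fixes g :: "real \<Rightarrow> real"
  assumes [measurable]: "g \<in> borel_measurable borel"
    and quad: "\<And>t. t > 0 \<Longrightarrow> \<bar>g t\<bar> \<le> A * t\<^sup>2"
    and bdd: "\<And>t. t > 0 \<Longrightarrow> \<bar>g t\<bar> \<le> B"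
    and p: "1 < p" "p < 3"
  shows "set_integrable lborel {0<..} (\<lambda>t. g t / t powr p)"
proof -
  have "set_integrable lborel {0<..1} (\<lambda>t. A * t powr (2 - p))"
    using p by (intro set_integrable_mult_right set_integrable_powr_to_0) auto
  then have "set_integrable lborel {0<..1} (\<lambda>t. g t / t powr p)"
  proof (rule set_integrable_bound)
    have "norm (g t / t powr p) \<le> norm (A * t powr (2 - p))" if "t \<in> {0<..1}" for t
    proof -
      have t: "t > 0" using that by simp
      have "\<bar>g t\<bar> / t powr p \<le> A * t\<^sup>2 / t powr p"
        using quad[OF t] by (intro divide_right_mono) auto
      also have "\<dots> = A * t powr (2 - p)"
        using t by (simp add: powr_diff)
      finally show ?thesis using t by (simp add: abs_le_iff)
    qed
    then show "AE t in lborel. t \<in> {0<..1} \<longrightarrow>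
        norm (g t / t powr p) \<le> norm (A * t powr (2 - p))" by blast
  qed (simp add: set_borel_measurable_def)
  moreover have "set_integrable lborel {1..} (\<lambda>t. B * t powr (- p))"
    using p by (intro set_integrable_mult_right set_integrable_powr_to_inf) auto
  then have "set_integrable lborel {1..} (\<lambda>t. g t / t powr p)"
  proof (rule set_integrable_bound)
    have "norm (g t / t powr p) \<le> norm (B * t powr (- p))" if "t \<in> {1..}" for t
    proof -
      have t: "t > 0" using that by simp
      have "\<bar>g t\<bar> / t powr p \<le> B / t powr p"
        using bdd[OF t] by (intro divide_right_mono) auto
      also have "\<dots> = B * t powr (- p)"
        by (simp add: powr_minus_divide)
      finally show ?thesis using t by (simp add: abs_le_iff)
    qed
    then show "AE t in lborel. t \<in> {1..} \<longrightarrow>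
        norm (g t / t powr p) \<le> norm (B * t powr (- p))" by blast
  qed (simp add: set_borel_measurable_def)
  ultimately have "set_integrable lborel ({0<..1} \<union> {1..}) (\<lambda>t. g t / t powr p)"
    by (rule set_integrable_Un) auto
  moreover have "{0<..1} \<union> {1..} = {0::real<..}" by auto
  ultimately show ?thesis by simp
qed

text \<open>The mean value inequality is used twice: \<open>Df\<close> vanishes at \<open>x\<close>
  and is Lipschitz with a bound \<open>K\<close> of \<open>D2f\<close> as constant, and this
  controls the increments of \<open>f\<close>.\<close>

lemma C2b_critical_point_quadratic_bound:
  fixes f :: "'a::real_normed_vector \<Rightarrow> real"
  assumes "C2b f" and crit: "(f has_derivative (\<lambda>_. 0)) (at x)"
  obtains K where "\<And>h. \<bar>f (x + h) - f x\<bar> \<le> K * (norm h)\<^sup>2"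
proof -
  obtain Df D2f where
    d1: "\<And>x. (f has_derivative blinfun_apply (Df x)) (at x)" and
    d2: "\<And>x. (Df has_derivative blinfun_apply (D2f x)) (at x)" and
    b: "bounded (range D2f)"
    using assms(1) unfolding C2b_def by blast
  obtain K where K: "\<And>y. norm (D2f y) \<le> K"
    using b by (auto simp: bounded_iff)
  have "K \<ge> 0" using K[of x] norm_ge_zero order_trans by blast
  have "blinfun_apply (Df x) = (\<lambda>_. 0)"
    using d1 crit by (rule has_derivative_unique)
  then have Df0: "Df x = 0"
    by (intro blinfun_eqI) simp
  have lip: "norm (Df y) \<le> K * norm (y - x)" for y
    using differentiable_bound[of UNIV Df "\<lambda>z. blinfun_apply (D2f z)" K y x] d2 K
    by (simp add: Df0 norm_blinfun.rep_eq[symmetric])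
  have "\<bar>f (x + h) - f x\<bar> \<le> K * (norm h)\<^sup>2" for h
  proof -
    have "norm (f (x + h) - f x) \<le> K * norm h * norm (x + h - x)"
    \<comment> \<open>This ball is convex, contains \<open>x\<close> and \<open>x + h\<close>, and
      on it \<open>lip\<close> bounds the derivative by \<open>K * norm h\<close>.\<close>
    proof (rule differentiable_bound[of "cball x (norm h)" f "\<lambda>z. blinfun_apply (Df z)"])
      fix y assume "y \<in> cball x (norm h)"
      then have "norm (y - x) \<le> norm h" by (simp add: dist_norm norm_minus_commute)
      then have "K * norm (y - x) \<le> K * norm h"
        using \<open>K \<ge> 0\<close> by (rule mult_left_mono)
      with lip[of y] show "onorm (blinfun_apply (Df y)) \<le> K * norm h"
        by (simp add: norm_blinfun.rep_eq[symmetric])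
    qed (auto simp: dist_norm intro: has_derivative_at_withinI d1)
    then show ?thesis by (simp add: power2_eq_square mult.assoc)
  qed
  then show thesis by (rule that)
qed

text \<open>This is the convergence of the one-sided integrals. The factor \<open>a\<close> stands
  for the component of a direction along which the function varies.\<close>

lemma C2b_critical_point_integrable:
  fixes f :: "real \<Rightarrow> real"
  assumes "C2b f" and crit: "(f has_derivative (\<lambda>_. 0)) (at t)" and p: "1 < p" "p < 3"
  shows "set_integrable lborel {0<..} (\<lambda>\<eta>. (f (t + \<eta> * a) - f t) / \<eta> powr p)"
proof -
  obtain K where K: "\<And>h. \<bar>f (t + h) - f t\<bar> \<le> K * (norm h)\<^sup>2"
    using C2b_critical_point_quadratic_bound[OF assms(1) crit] by blast
  obtain M where M: "\<And>u. \<bar>f u\<bar> \<le> M"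
    using assms(1) unfolding C2b_def bounded_iff by auto
  have "continuous_on UNIV f"
    using assms(1) unfolding C2b_def by blast
  then have [measurable]: "f \<in> borel_measurable borel"
    by (rule borel_measurable_continuous_onI)
  show ?thesis
  proof (rule set_integrable_over_powr[OF _ _ _ p])
    show "\<bar>f (t + \<eta> * a) - f t\<bar> \<le> (K * a\<^sup>2) * \<eta>\<^sup>2" for \<eta>
      using K[of "\<eta> * a"] by (simp add: power_mult_distrib mult_ac)
    show "\<bar>f (t + \<eta> * a) - f t\<bar> \<le> 2 * M" for \<eta>
      using M[of "t + \<eta> * a"] M[of t] by linarith
  qed measurable
qed

theorem lemma6p3:
  fixes s :: real and \<Phi> :: "real \<Rightarrow> real" and \<phi> :: "real ^ 'n::finite \<Rightarrow> real" and k :: 'n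
  assumes "CARD('n) \<ge> 2"
    and "1 / 2 < s" and "s < 1"
    and "C2b \<Phi>" and "mono \<Phi>"
    and "\<And>x. \<phi> x = \<Phi> (x $ k)"
  shows "\<forall>x. frac_inf_laplacian s \<phi> x = - frac_laplacian_1d s \<Phi> (x $ k)"
proof
  fix x :: "real ^ 'n"
  define t p where "t = x $ k" and "p = 1 + 2 * s"
  define e :: "real ^ 'n" where "e = axis k 1"
  have e: "e $ k = 1" "norm e = 1" by (simp_all add: e_def)
  obtain Df where "(\<Phi> has_derivative blinfun_apply Df) (at t)"
    using \<open>C2b \<Phi>\<close> unfolding C2b_def by blast
  then obtain d where d: "(\<Phi> has_real_derivative d) (at t)"
    by (meson differentiableI real_differentiable_def)
  have "d \<ge> 0"
    using mono_on_imp_deriv_nonneg[of UNIV \<Phi> d t] d \<open>mono \<Phi>\<close> by simp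
  have "GDERIV (\<lambda>x. x $ k) x :> e"
    unfolding gderiv_def e_def
    by (auto simp: inner_axis intro: bounded_linear_imp_has_derivative bounded_linear_vec_nth)
  then have "GDERIV \<phi> x :> d *\<^sub>R e"
    using GDERIV_DERIV_compose[of "\<lambda>x. x $ k" x e \<Phi> d] d
    unfolding assms(6)[abs_def] t_def by simp
  then have grad: "grad \<phi> x = d *\<^sub>R e" by (rule grad_eqI)
  show "frac_inf_laplacian s \<phi> x = - frac_laplacian_1d s \<Phi> (x $ k)"
  proof (cases "d = 0")
    case False
    with \<open>d \<ge> 0\<close> e have "grad \<phi> x \<noteq> 0" "grad \<phi> x /\<^sub>R norm (grad \<phi> x) = e"
      unfolding grad by auto
    then show ?thesis
      by (simp add: frac_inf_laplacian_def frac_laplacian_1d_def Let_def assms(6) e(1))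
  next
    case True
    with d have crit: "(\<Phi> has_derivative (\<lambda>_. 0)) (at t)"
      by (simp add: has_field_derivative_def lambda_zero)
    \<comment> \<open>Since \<open>\<phi>\<close> sees only component \<open>k\<close>, the
      one-sided integrals for a unit vector \<open>y\<close> are \<open>I (y $ k)\<close> and
      \<open>I (- (y $ k))\<close>. The supremum and infimum thus reduce to one real
      parameter.\<close>
    define I where "I a = (LBINT \<eta>:{0<..}. (\<Phi> (t + \<eta> * a) - \<Phi> t) / \<eta> powr p)" for a
    have int: "set_integrable lborel {0<..} (\<lambda>\<eta>. (\<Phi> (t + \<eta> * a) - \<Phi> t) / \<eta> powr p)" for a
      using C2b_critical_point_integrable[OF \<open>C2b \<Phi>\<close> crit] assms(2,3) by (simp add: p_def)
    have I_mono: "I a \<le> I b" if "a \<le> b" for a b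
      unfolding I_def
    proof (rule set_integral_mono[OF int int])
      fix \<eta> :: real assume "\<eta> \<in> {0<..}"
      with that have "t + \<eta> * a \<le> t + \<eta> * b" by simp
      from monoD[OF \<open>mono \<Phi>\<close> this]
      show "(\<Phi> (t + \<eta> * a) - \<Phi> t) / \<eta> powr p \<le> (\<Phi> (t + \<eta> * b) - \<Phi> t) / \<eta> powr p"
        by (intro divide_right_mono) auto
    qed
    have le1: "y $ k \<le> 1" if "norm y = 1" for y :: "real ^ 'n"
      using component_le_norm_cart[of y k] that by simp
    have sup: "(SUP y\<in>{y :: real ^ 'n. norm y = 1}. I (y $ k)) = I 1"
      using e by (intro cSup_eq_maximum) (auto intro: I_mono le1 image_eqI[of _ _ e])
    \<comment> \<open>The reflection in \<open>x - \<eta> *\<^sub>R y\<close> turns the largest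
      component into the smallest argument of \<open>I\<close>, so \<open>e\<close> is again
      extremal.\<close>
    have inf: "(INF y\<in>{y :: real ^ 'n. norm y = 1}. I (- (y $ k))) = I (- 1)"
      using e by (intro cInf_eq_minimum) (auto intro: I_mono le_imp_neg_le[OF le1] image_eqI[of _ _ e])
    have "frac_inf_laplacian s \<phi> x = frac_const s * I 1 + frac_const s * I (- 1)"
      unfolding sup[symmetric] inf[symmetric]
      by (simp add: frac_inf_laplacian_def grad True assms(6) I_def t_def p_def)
    \<comment> \<open>Adding the two first differences gives the second difference; merging the
      integrals is allowed because each converges by \<open>int\<close>.\<close>
    also have "I 1 + I (- 1) =
        (LBINT \<eta>:{0<..}. (\<Phi> (t + \<eta>) + \<Phi> (t - \<eta>) - 2 * \<Phi> t) / \<eta> powr p)"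
      unfolding I_def set_integral_add(2)[OF int int, symmetric]
      by (simp add: add_divide_distrib[symmetric] algebra_simps)
    then have "frac_const s * I 1 + frac_const s * I (- 1) = - frac_laplacian_1d s \<Phi> (x $ k)"
      by (simp add: frac_laplacian_1d_def t_def p_def distrib_left[symmetric])
    finally show ?thesis .
  qed
qed

end
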